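(* Let $\lambda=(\lambda_1,\lambda_2,\dots)$ be a (finite or infinite) sequence of natural numbers and let $\mathcal A(\lambda)$ be the rooted $\lambda$-ary tree with root $0$. Then the array $Y_{b,\lambda}$ of bracket sequences with $\lambda_i$ types of bracket in the $i$-th layer of nesting is equivalent to the path array $Y_{(\mathcal A(\lambda),0)}$; that is, $Y_{b,\lambda}$ is a Pascal $(\mathcal A(\lambda),0)$-array.
   Context: $\mathbb N=\{0,1,2,\dots\}$. A finite sequence $\lambda=(\lambda_1,\dots,\lambda_k)$ is regarded as the infinite sequence obtained by repeating its last entry $\lambda_k$ forever. The rooted $\lambda$-ary tree $\mathcal A(\lambda)$ is the undirected tree whose vertices are the finite sequences $(d_1,\dots,d_j)$, $j\ge0$, with $1\le d_i\le\lambda_i$ for all $i$; the root $0$ is the empty sequence, and there is an (undirected) edge between $(d_1,\dots,d_{j})$ and $(d_1,\dots,d_{j},d_{j+1})$ for each such pair. So the root has $\lambda_1$ children, each of these has $\lambda_2$ children, and so on. An undirected edge is regarded as two opposite directed edges. For a rooted graph $(G,v_0)$ with vertices $V$, directed edges $E$, and initial/final maps $i,f:E\to V$, a Pascal $(G,v_0)$-array (= array equivalent to the path array $Y_{G,v_0}$, where $Y_{G,v_0}(n;v)$ is the set of directed paths of length $n$ from $v_0$ to $v$) is a family of sets $Y(n;v)$, $n\in\mathbb N$, $v\in V$, with $Y(0;v_0)$ a singleton and $Y(0;v)=\emptyset$ for $v\neq v_0$, for which there are injective edge maps $\phi'_e:Y(n-1;i(e))\hookrightarrow Y(n;f(e))$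 ($e\in E$, $n\ge1$) such that $Y(n;v)=\bigsqcup_{e:\,f(e)=v}\phi'_e(Y(n-1;i(e)))$ (disjoint union). Bracket sequences: consider sequences of typed open and close brackets which are properly nested but not necessarily closed (each close bracket closes the most recent as yet unmatched open bracket, and has the same type), such that a bracket opened when exactly $j-1$ earlier brackets are open and not yet closed (a bracket in the $j$-th layer of nesting) has one of $\lambda_j$ possible types, labelled $1,\dots,\lambda_j$. $Y_{b,\lambda}(n;(d_1,\dots,d_j))$ is the set of such sequences consisting of $n$ individual brackets with exactly $j$ unmatched open brackets, whose types are $d_1,d_2,\dots,d_j$ in order from left to right. *)

theory Defs
  imports "Graph_Theory.Arc_Walk" "HOL-Library.Disjoint_Sets"
begin

section \<open>Pascal arrays of a rooted graph\<close>

text \<open>Repeated vertices and arcs are allowed in a directed path, so paths are the library's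
  arc walks.\<close>

definition path_array :: "('v, 'e) pre_digraph \<Rightarrow> 'v \<Rightarrow> nat \<Rightarrow> 'v \<Rightarrow> 'e list set" where
  "path_array G v0 n v = {p. pre_digraph.awalk G v0 p v \<and> length p = n}"

text \<open>The map of the arc \<open>e\<close> from level \<open>n\<close> to level \<open>Suc n\<close> is \<open>\<phi> n e\<close>.\<close>

definition edge_maps ::
  "('v, 'e) pre_digraph \<Rightarrow> (nat \<Rightarrow> 'v \<Rightarrow> 'y set) \<Rightarrow> (nat \<Rightarrow> 'e \<Rightarrow> 'y \<Rightarrow> 'y) \<Rightarrow> bool" where
  "edge_maps G Y \<phi> \<longleftrightarrow>
     (\<forall>n. \<forall>e\<in>arcs G. inj_on (\<phi> n e) (Y n (tail G e)) \<and>
                      \<phi> n e ` Y n (tail G e) \<subseteq> Y (Suc n) (head G e)) \<and>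
     (\<forall>n. \<forall>v\<in>verts G.
        disjoint_family_on (\<lambda>e. \<phi> n e ` Y n (tail G e)) (in_arcs G v) \<and>
        Y (Suc n) v = (\<Union>e\<in>in_arcs G v. \<phi> n e ` Y n (tail G e)))"

definition rooted_array :: "('v, 'e) pre_digraph \<Rightarrow> 'v \<Rightarrow> (nat \<Rightarrow> 'v \<Rightarrow> 'y set) \<Rightarrow> bool" where
  "rooted_array G v0 Y \<longleftrightarrow> is_singleton (Y 0 v0) \<and> (\<forall>v\<in>verts G. v \<noteq> v0 \<longrightarrow> Y 0 v = {})"

definition pascal_array :: "('v, 'e) pre_digraph \<Rightarrow> 'v \<Rightarrow> (nat \<Rightarrow> 'v \<Rightarrow> 'y set) \<Rightarrow> bool" where
  "pascal_array G v0 Y \<longleftrightarrow> rooted_array G v0 Y \<and> (\<exists>\<phi>. edge_maps G Y \<phi>)"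

text \<open>An equivalence with the path array is a family of bijections \<open>\<theta> n v\<close> that carries edge maps
  of \<open>Y\<close> to the edge maps of the path array, which append an arc at the end of a path.\<close>

definition equivalent_to_path_array ::
  "('v, 'e) pre_digraph \<Rightarrow> 'v \<Rightarrow> (nat \<Rightarrow> 'v \<Rightarrow> 'y set) \<Rightarrow> bool" where
  "equivalent_to_path_array G v0 Y \<longleftrightarrow>
     (\<exists>\<phi> \<theta>. edge_maps G Y \<phi> \<and>
        (\<forall>n. \<forall>v\<in>verts G. bij_betw (\<theta> n v) (Y n v) (path_array G v0 n v)) \<and>
        (\<forall>n. \<forall>e\<in>arcs G. \<forall>y\<in>Y n (tail G e).
           \<theta> (Suc n) (head G e) (\<phi> n e y) = \<theta> n (tail G e) y @ [e]))"


section \<open>The rooted tree of a finite or infinite sequence\<close>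

datatype nat_sequence = Finite "nat list" | Infinite "nat \<Rightarrow> nat"

text \<open>Indices start at 0: \<open>entry \<Lambda> i\<close> is $\lambda_{i+1}$. A finite sequence repeats its last entry.\<close>

fun entry :: "nat_sequence \<Rightarrow> nat \<Rightarrow> nat" where
  "entry (Finite xs) i = (if i < length xs then xs ! i else last xs)"
| "entry (Infinite f) i = f i"

definition tree_verts :: "nat_sequence \<Rightarrow> nat list set" where
  "tree_verts \<Lambda> = {ds. \<forall>i<length ds. 1 \<le> ds ! i \<and> ds ! i \<le> entry \<Lambda> i}"

text \<open>Each undirected edge gives two opposite arcs.\<close>

definition ary_tree :: "nat_sequence \<Rightarrow> (nat list, nat list \<times> nat list) pre_digraph" where
  "ary_tree \<Lambda> =
     \<lparr> verts = tree_verts \<Lambda>,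
       arcs = {(u, u @ [d]) | u d. u @ [d] \<in> tree_verts \<Lambda>} \<union>
              {(u @ [d], u) | u d. u @ [d] \<in> tree_verts \<Lambda>},
       tail = fst, head = snd \<rparr>"

lemma wf_digraph_ary_tree: "wf_digraph (ary_tree \<Lambda>)"
proof -
  have *: "u \<in> tree_verts \<Lambda>" if "u @ [d] \<in> tree_verts \<Lambda>" for u d
    unfolding tree_verts_def
  proof (intro CollectI allI impI)
    fix i assume "i < length u"
    then show "1 \<le> u ! i \<and> u ! i \<le> entry \<Lambda> i"
      using that by (auto simp: tree_verts_def nth_append dest!: spec[of _ i])
  qed
  show ?thesis by unfold_locales (auto simp: ary_tree_def intro: *)
qed

lemma root_in_ary_tree: "[] \<in> verts (ary_tree \<Lambda>)"
  by (simp add: ary_tree_def tree_verts_def)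


section \<open>Bracket sequences\<close>

datatype bracket = Open nat | Close nat

text \<open>The types of the unmatched open brackets after reading a sequence, from left to right.
  A close bracket removes the most recent one; that there is one, and that it has the same type, is
  required in \<open>properly_nested\<close>.\<close>

definition unmatched :: "bracket list \<Rightarrow> nat list" where
  "unmatched w = foldl (\<lambda>s b. case b of Open d \<Rightarrow> s @ [d] | Close d \<Rightarrow> butlast s) [] w"

definition properly_nested :: "nat_sequence \<Rightarrow> bracket list \<Rightarrow> bool" where
  "properly_nested \<Lambda> w \<longleftrightarrow>
     (\<forall>k<length w. let s = unmatched (take k w) in
        case w ! k of
          Open d \<Rightarrow> 1 \<le> d \<and> d \<le> entry \<Lambda> (length s)
        | Close d \<Rightarrow> s \<noteq> [] \<and> last s = d)"

definition bracket_array :: "nat_sequence \<Rightarrow> nat \<Rightarrow> nat list \<Rightarrow> bracket list set" where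
  "bracket_array \<Lambda> n ds = {w. properly_nested \<Lambda> w \<and> length w = n \<and> unmatched w = ds}"

end

theory Submission
  imports Defs
begin

text \<open>
  Reading a bracket sequence from left to right, the list of unmatched open brackets performs a walk
  on the tree: an open bracket of type \<open>d\<close> moves from \<open>u\<close> to its child \<open>u @ [d]\<close>, and a
  close bracket moves from a vertex to its parent. Being properly nested says exactly that every
  step of this walk is possible, and each arc is traversed by exactly one bracket, \<open>arc_bracket\<close>.
  So the sequences of length \<open>Suc n\<close> that end at \<open>v\<close> arise, each in one way, from the sequences of
  length \<open>n\<close> at the neighbours of \<open>v\<close> by appending one bracket; these appending maps are the edge
  maps (\<open>edge_maps_bracket_array\<close>).

  The equivalence with the path array holds for every Pascal array: tracing the
  unique origin of an element back to level 0 yields the path that corresponds to it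
  (\<open>edge_maps_imp_equivalent_to_path_array\<close>).
\<close>

section \<open>Pascal arrays and path arrays\<close>

lemma path_array_0:
  assumes "wf_digraph G" "v0 \<in> verts G"
  shows "path_array G v0 0 v = (if v = v0 then {[]} else {})"
  using assms by (auto simp: path_array_def wf_digraph.awalk_Nil_iff)

lemma path_array_Suc:
  assumes "wf_digraph G" "v0 \<in> verts G"
  shows "path_array G v0 (Suc n) v =
           (\<Union>e\<in>in_arcs G v. (\<lambda>p. p @ [e]) ` path_array G v0 n (tail G e))"
proof -
  interpret wf_digraph G by fact
  have snoc: "awalk v0 (p @ [e]) v \<longleftrightarrow> awalk v0 p (tail G e) \<and> e \<in> in_arcs G v" for p e
    by (auto simp: awalk_simps)
  show ?thesis
  proof (intro set_eqI iffI)
    fix q assume q: "q \<in> path_array G v0 (Suc n) v"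
    then have "q \<noteq> []" by (auto simp: path_array_def)
    then obtain p e where "q = p @ [e]" by (cases q rule: rev_cases) auto
    with q snoc show "q \<in> (\<Union>e\<in>in_arcs G v. (\<lambda>p. p @ [e]) ` path_array G v0 n (tail G e))"
      unfolding path_array_def by (intro UN_I[of e]) auto
  next
    fix q assume "q \<in> (\<Union>e\<in>in_arcs G v. (\<lambda>p. p @ [e]) ` path_array G v0 n (tail G e))"
    then obtain e p where e: "e \<in> in_arcs G v" "awalk v0 p (tail G e)"
      and q: "length p = n" "q = p @ [e]"
      unfolding path_array_def by blast
    have "awalk v0 (p @ [e]) v" using snoc e by blast
    with q show "q \<in> path_array G v0 (Suc n) v"
      by (simp add: path_array_def)
  qed
qed

text \<open>When \<open>\<phi>\<close> is a family of edge maps, the choice is between no alternatives: disjointness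
  determines the arc \<open>e\<close>, and then injectivity of \<open>\<phi> n e\<close> determines the origin \<open>y\<close>.\<close>

fun traced_path ::
  "('v, 'e) pre_digraph \<Rightarrow> (nat \<Rightarrow> 'v \<Rightarrow> 'y set) \<Rightarrow> (nat \<Rightarrow> 'e \<Rightarrow> 'y \<Rightarrow> 'y) \<Rightarrow> nat \<Rightarrow> 'v \<Rightarrow> 'y \<Rightarrow> 'e list"
where
  "traced_path G Y \<phi> 0 v x = []"
| "traced_path G Y \<phi> (Suc n) v x =
     (let (e, y) = SOME (e, y). e \<in> in_arcs G v \<and> y \<in> Y n (tail G e) \<and> \<phi> n e y = x
      in traced_path G Y \<phi> n (tail G e) y @ [e])"

lemma edge_maps_unique_origin:
  assumes "edge_maps G Y \<phi>" "v \<in> verts G"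
    and e: "e \<in> in_arcs G v" "y \<in> Y n (tail G e)"
    and e': "e' \<in> in_arcs G v" "y' \<in> Y n (tail G e')"
    and eq: "\<phi> n e y = \<phi> n e' y'"
  shows "e = e'" "y = y'"
proof -
  have disj: "disjoint_family_on (\<lambda>e. \<phi> n e ` Y n (tail G e)) (in_arcs G v)"
    using assms(1,2) by (simp add: edge_maps_def)
  show "e = e'"
  proof (rule ccontr)
    assume "e \<noteq> e'"
    then have "\<phi> n e ` Y n (tail G e) \<inter> \<phi> n e' ` Y n (tail G e') = {}"
      using disjoint_family_onD[OF disj e(1) e'(1)] by blast
    moreover have "\<phi> n e y \<in> \<phi> n e ` Y n (tail G e)" "\<phi> n e y \<in> \<phi> n e' ` Y n (tail G e')"
      using imageI[OF e(2), of "\<phi> n e"] imageI[OF e'(2), of "\<phi> n e'"] unfolding eq by blast+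
    ultimately show False by blast
  qed
  moreover have "inj_on (\<phi> n e) (Y n (tail G e))"
    using assms(1) e(1) by (simp add: edge_maps_def)
  ultimately show "y = y'"
    using e(2) e'(2) eq by (auto dest: inj_onD)
qed

lemma traced_path_edge_map:
  assumes "wf_digraph G" "edge_maps G Y \<phi>" "e \<in> arcs G" "y \<in> Y n (tail G e)"
  shows "traced_path G Y \<phi> (Suc n) (head G e) (\<phi> n e y) = traced_path G Y \<phi> n (tail G e) y @ [e]"
proof -
  have v: "head G e \<in> verts G" and e: "e \<in> in_arcs G (head G e)"
    using assms by (simp_all add: wf_digraph.head_in_verts)
  have "(SOME (e', y'). e' \<in> in_arcs G (head G e) \<and> y' \<in> Y n (tail G e') \<and> \<phi> n e' y' = \<phi> n e y)
        = (e, y)"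
  proof (rule some_equality)
    show "case (e, y) of (e', y') \<Rightarrow>
        e' \<in> in_arcs G (head G e) \<and> y' \<in> Y n (tail G e') \<and> \<phi> n e' y' = \<phi> n e y"
      using e assms(4) by simp
  next
    fix z
    assume "case z of (e', y') \<Rightarrow>
        e' \<in> in_arcs G (head G e) \<and> y' \<in> Y n (tail G e') \<and> \<phi> n e' y' = \<phi> n e y"
    then show "z = (e, y)"
      using edge_maps_unique_origin[OF assms(2) v _ _ e assms(4)] by (cases z) blast
  qed
  then show ?thesis by simp
qed

text \<open>Both arrays satisfy the same recursion, whose summands are disjoint: for \<open>Y\<close> by assumption, for
  paths because the last arc can be read off. So bijections at level \<open>n\<close> extend to level
  \<open>Suc n\<close>, starting from two singletons at the root.\<close>

lemma bij_betw_traced_path: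
  assumes "wf_digraph G" "v0 \<in> verts G" "rooted_array G v0 Y" "edge_maps G Y \<phi>" "v \<in> verts G"
  shows "bij_betw (traced_path G Y \<phi> n v) (Y n v) (path_array G v0 n v)"
  using assms(5)
proof (induction n arbitrary: v)
  case 0
  then show ?case
    using assms(3) unfolding bij_betw_def rooted_array_def path_array_0[OF assms(1,2)]
    by (auto simp: is_singleton_def)
next
  case (Suc n)
  have YSuc: "Y (Suc n) v = (\<Union>e\<in>in_arcs G v. \<phi> n e ` Y n (tail G e))"
    using assms(4) Suc.prems by (simp add: edge_maps_def)
  have tail: "tail G e \<in> verts G" if "e \<in> in_arcs G v" for e
    using assms(1) that by (simp add: wf_digraph.tail_in_verts)
  have step: "traced_path G Y \<phi> (Suc n) v (\<phi> n e y) = traced_path G Y \<phi> n (tail G e) y @ [e]"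
    if "e \<in> in_arcs G v" "y \<in> Y n (tail G e)" for e y
    using traced_path_edge_map[where y = y, OF assms(1,4)] that by auto
  show ?case
    unfolding bij_betw_def
  proof
    show "inj_on (traced_path G Y \<phi> (Suc n) v) (Y (Suc n) v)"
    proof (rule inj_onI)
      fix x x'
      assume "x \<in> Y (Suc n) v" "x' \<in> Y (Suc n) v"
        and eq: "traced_path G Y \<phi> (Suc n) v x = traced_path G Y \<phi> (Suc n) v x'"
      then obtain e y e' y' where
        x: "e \<in> in_arcs G v" "y \<in> Y n (tail G e)" "x = \<phi> n e y" and
        x': "e' \<in> in_arcs G v" "y' \<in> Y n (tail G e')" "x' = \<phi> n e' y'"
        unfolding YSuc by auto
      have "traced_path G Y \<phi> n (tail G e) y @ [e] = traced_path G Y \<phi> n (tail G e') y' @ [e']"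
        using eq unfolding x(3) x'(3) step[OF x(1,2)] step[OF x'(1,2)] .
      then have "e = e'" "traced_path G Y \<phi> n (tail G e) y = traced_path G Y \<phi> n (tail G e) y'"
        by auto
      moreover have "inj_on (traced_path G Y \<phi> n (tail G e)) (Y n (tail G e))"
        using Suc.IH[OF tail[OF x(1)]] by (rule bij_betw_imp_inj_on)
      ultimately have "y = y'"
        using x(2) x'(2) by (auto dest: inj_onD)
      with x x' \<open>e = e'\<close> show "x = x'" by simp
    qed
  next
    have "traced_path G Y \<phi> (Suc n) v ` Y (Suc n) v =
          (\<Union>e\<in>in_arcs G v. (\<lambda>p. p @ [e]) ` traced_path G Y \<phi> n (tail G e) ` Y n (tail G e))"
      unfolding YSuc image_UN image_image
      by (intro SUP_cong[OF refl] image_cong[OF refl] step)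
    also have "\<dots> = (\<Union>e\<in>in_arcs G v. (\<lambda>p. p @ [e]) ` path_array G v0 n (tail G e))"
      using Suc.IH[OF tail] by (intro SUP_cong) (simp_all add: bij_betw_def)
    also have "\<dots> = path_array G v0 (Suc n) v"
      by (simp only: path_array_Suc[OF assms(1,2)])
    finally show "traced_path G Y \<phi> (Suc n) v ` Y (Suc n) v = path_array G v0 (Suc n) v" .
  qed
qed

lemma edge_maps_imp_equivalent_to_path_array:
  assumes "wf_digraph G" "v0 \<in> verts G" "rooted_array G v0 Y" "edge_maps G Y \<phi>"
  shows "equivalent_to_path_array G v0 Y"
  unfolding equivalent_to_path_array_def
proof (intro exI conjI allI ballI)
  show "edge_maps G Y \<phi>" by fact
  show "bij_betw (traced_path G Y \<phi> n v) (Y n v) (path_array G v0 n v)" if "v \<in> verts G" for n v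
    using bij_betw_traced_path[OF assms that] .
  show "traced_path G Y \<phi> (Suc n) (head G e) (\<phi> n e y) = traced_path G Y \<phi> n (tail G e) y @ [e]"
    if "e \<in> arcs G" "y \<in> Y n (tail G e)" for n e y
    using traced_path_edge_map[OF assms(1,4) that] .
qed


section \<open>Bracket sequences as walks on the tree\<close>

lemma tree_verts_snoc:
  "u @ [d] \<in> tree_verts \<Lambda> \<longleftrightarrow> u \<in> tree_verts \<Lambda> \<and> 1 \<le> d \<and> d \<le> entry \<Lambda> (length u)"
  by (auto simp: tree_verts_def nth_append less_Suc_eq)

lemma unmatched_snoc:
  "unmatched (w @ [b]) =
     (case b of Open d \<Rightarrow> unmatched w @ [d] | Close d \<Rightarrow> butlast (unmatched w))"
  by (simp add: unmatched_def split: bracket.split)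

lemma properly_nested_snoc:
  "properly_nested \<Lambda> (w @ [b]) \<longleftrightarrow> properly_nested \<Lambda> w \<and>
     (case b of
        Open d \<Rightarrow> 1 \<le> d \<and> d \<le> entry \<Lambda> (length (unmatched w))
      | Close d \<Rightarrow> unmatched w \<noteq> [] \<and> last (unmatched w) = d)"
proof -
  have "properly_nested \<Lambda> (w @ [b]) \<longleftrightarrow>
      (\<forall>k<length w. let s = unmatched (take k (w @ [b])) in
        case (w @ [b]) ! k of
          Open d \<Rightarrow> 1 \<le> d \<and> d \<le> entry \<Lambda> (length s)
        | Close d \<Rightarrow> s \<noteq> [] \<and> last s = d) \<and>
      (let s = unmatched (take (length w) (w @ [b])) in
        case (w @ [b]) ! length w of
          Open d \<Rightarrow> 1 \<le> d \<and> d \<le> entry \<Lambda> (length s)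
        | Close d \<Rightarrow> s \<noteq> [] \<and> last s = d)"
    unfolding properly_nested_def length_append_singleton All_less_Suc by (rule conj_commute)
  then show ?thesis by (simp add: properly_nested_def nth_append Let_def)
qed

lemma unmatched_in_tree_verts:
  "properly_nested \<Lambda> w \<Longrightarrow> unmatched w \<in> tree_verts \<Lambda>"
proof (induction w rule: rev_induct)
  case Nil
  then show ?case by (simp add: unmatched_def tree_verts_def)
next
  case (snoc b w)
  then have IH: "unmatched w \<in> tree_verts \<Lambda>" by (simp add: properly_nested_snoc)
  show ?case
  proof (cases b)
    case (Open d)
    with snoc.prems IH show ?thesis
      by (simp add: properly_nested_snoc unmatched_snoc tree_verts_snoc)
  next
    case (Close d)
    with snoc.prems have "unmatched w = butlast (unmatched w) @ [d]"
      by (auto simp: properly_nested_snoc)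
    with IH have "butlast (unmatched w) \<in> tree_verts \<Lambda>"
      by (metis tree_verts_snoc)
    with Close show ?thesis by (simp add: unmatched_snoc)
  qed
qed

lemma tail_head_ary_tree: "tail (ary_tree \<Lambda>) = fst" "head (ary_tree \<Lambda>) = snd"
  by (simp_all add: ary_tree_def)

text \<open>Arcs away from the root are told apart from arcs towards it by the lengths of their ends.\<close>

definition arc_bracket :: "nat list \<times> nat list \<Rightarrow> bracket" where
  "arc_bracket e =
     (if length (fst e) < length (snd e) then Open (last (snd e)) else Close (last (fst e)))"

text \<open>One step of the walk. The arc determines the bracket: an arc to a child carries the type of the
  opened bracket, and an arc to the parent must close the last unmatched bracket, whose type is
  the last entry of the tail. Conversely, the bracket determines the head of the arc.\<close>

lemma append_bracket_iff_arc:
  assumes "properly_nested \<Lambda> w"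
  shows "properly_nested \<Lambda> (w @ [b]) \<and> unmatched (w @ [b]) = v \<longleftrightarrow>
         (unmatched w, v) \<in> arcs (ary_tree \<Lambda>) \<and> b = arc_bracket (unmatched w, v)"
proof -
  have u: "unmatched w \<in> tree_verts \<Lambda>"
    using assms by (rule unmatched_in_tree_verts)
  show ?thesis
  proof (cases b)
    case (Open d)
    then show ?thesis
      using assms u
      by (auto simp: properly_nested_snoc unmatched_snoc ary_tree_def arc_bracket_def
            tree_verts_snoc)
  next
    case (Close d)
    show ?thesis
    proof (cases "unmatched w" rule: rev_cases)
      case Nil
      with Close show ?thesis
        by (auto simp: properly_nested_snoc ary_tree_def arc_bracket_def)
    next
      case (snoc u d')
      with Close u assms show ?thesis
        by (auto simp: properly_nested_snoc unmatched_snoc ary_tree_def arc_bracket_def)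
    qed
  qed
qed

lemma rooted_array_bracket_array: "rooted_array (ary_tree \<Lambda>) [] (bracket_array \<Lambda>)"
proof -
  have "bracket_array \<Lambda> 0 v = (if v = [] then {[]} else {})" for v
    by (auto simp: bracket_array_def properly_nested_def unmatched_def)
  then show ?thesis by (simp add: rooted_array_def is_singleton_def)
qed

lemma bracket_array_Suc:
  "bracket_array \<Lambda> (Suc n) v =
     (\<Union>e\<in>in_arcs (ary_tree \<Lambda>) v. (\<lambda>w. w @ [arc_bracket e]) ` bracket_array \<Lambda> n (tail (ary_tree \<Lambda>) e))"
    (is "_ = ?R")
proof (intro set_eqI iffI)
  fix x assume x: "x \<in> bracket_array \<Lambda> (Suc n) v"
  then obtain w b where wb: "x = w @ [b]"
    by (cases x rule: rev_cases) (auto simp: bracket_array_def)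
  with x have w: "properly_nested \<Lambda> w" "length w = n"
    by (auto simp: bracket_array_def properly_nested_snoc)
  with x wb have "(unmatched w, v) \<in> arcs (ary_tree \<Lambda>)" "b = arc_bracket (unmatched w, v)"
    using append_bracket_iff_arc[OF w(1), of b v] by (auto simp: bracket_array_def)
  with w wb show "x \<in> ?R"
    by (intro UN_I[of "(unmatched w, v)"]) (auto simp: bracket_array_def ary_tree_def)
next
  fix x assume "x \<in> ?R"
  then obtain e w where e: "e \<in> arcs (ary_tree \<Lambda>)" "snd e = v"
    and w: "w \<in> bracket_array \<Lambda> n (fst e)" and x: "x = w @ [arc_bracket e]"
    by (auto simp: tail_head_ary_tree)
  from w have "properly_nested \<Lambda> w" "(unmatched w, v) = e"
    using e by (auto simp: bracket_array_def)
  with e x w show "x \<in> bracket_array \<Lambda> (Suc n) v"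
    using append_bracket_iff_arc[of \<Lambda> w "arc_bracket e" v] by (simp add: bracket_array_def)
qed

lemma edge_maps_bracket_array:
  "edge_maps (ary_tree \<Lambda>) (bracket_array \<Lambda>) (\<lambda>n e w. w @ [arc_bracket e])"
proof -
  \<comment> \<open>Arcs with a common head are distinguished by their tails, and the tail is recovered from a
    sequence in the image as the unmatched brackets before the last bracket.\<close>
  have disj: "disjoint_family_on
      (\<lambda>e. (\<lambda>w. w @ [arc_bracket e]) ` bracket_array \<Lambda> n (tail (ary_tree \<Lambda>) e))
      (in_arcs (ary_tree \<Lambda>) v)" for n v
    unfolding disjoint_family_on_def
  proof (intro ballI impI)
    fix e e'
    assume "e \<in> in_arcs (ary_tree \<Lambda>) v" "e' \<in> in_arcs (ary_tree \<Lambda>) v" "e \<noteq> e'"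
    then have "fst e \<noteq> fst e'"
      by (simp add: tail_head_ary_tree prod_eq_iff)
    then show "(\<lambda>w. w @ [arc_bracket e]) ` bracket_array \<Lambda> n (tail (ary_tree \<Lambda>) e) \<inter>
        (\<lambda>w. w @ [arc_bracket e']) ` bracket_array \<Lambda> n (tail (ary_tree \<Lambda>) e') = {}"
      by (auto simp: bracket_array_def tail_head_ary_tree)
  qed
  have "(\<lambda>w. w @ [arc_bracket e]) ` bracket_array \<Lambda> n (tail (ary_tree \<Lambda>) e)
      \<subseteq> bracket_array \<Lambda> (Suc n) (head (ary_tree \<Lambda>) e)" if "e \<in> arcs (ary_tree \<Lambda>)" for n e
    unfolding bracket_array_Suc using that by (intro UN_upper) simp
  with disj show ?thesis
    unfolding edge_maps_def by (intro conjI allI ballI bracket_array_Suc) (auto intro: inj_onI)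
qed

theorem proposition6p4:
  fixes \<Lambda> :: nat_sequence
  assumes "\<Lambda> \<noteq> Finite []"
  shows "equivalent_to_path_array (ary_tree \<Lambda>) [] (bracket_array \<Lambda>) \<and>
         pascal_array (ary_tree \<Lambda>) [] (bracket_array \<Lambda>)"
proof
  show "equivalent_to_path_array (ary_tree \<Lambda>) [] (bracket_array \<Lambda>)"
    using wf_digraph_ary_tree root_in_ary_tree rooted_array_bracket_array edge_maps_bracket_array
    by (rule edge_maps_imp_equivalent_to_path_array)
  show "pascal_array (ary_tree \<Lambda>) [] (bracket_array \<Lambda>)"
    using rooted_array_bracket_array edge_maps_bracket_array by (auto simp: pascal_array_def)
qed

end
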